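(* Let $K$ and $K'$ be oriented knots in $S^3$. If there exists a surjective quandle homomorphism $Q(K)\to Q(K')$ from the knot quandle of $K$ onto the knot quandle of $K'$, then \[\Phi^{ts,+}_X(K)\succ\Phi^{ts,+}_X(K')\] for every finite Alexander quandle $X$.
   Context: A rack is a set with two binary operations $\triangleright,\triangleright^{-1}$ satisfying for all $x,y,z$: $(x\triangleright y)\triangleright^{-1}y=x=(x\triangleright^{-1}y)\triangleright y$ and $(x\triangleright y)\triangleright z=(x\triangleright z)\triangleright(y\triangleright z)$. A quandle is a rack with $x\triangleright x=x$ for all $x$. Rack/quandle homomorphisms are maps preserving both operations. The knot quandle $Q(K)$ is the quandle generated by the arcs of an oriented diagram of $K$, with one relation $z=x\triangleright y$ for each crossing, where $y$ is the overcrossing arc, $x$ is the under-arc on the right of $y$, and $z$ is the under-arc on the left of $y$ (right and left with respect to the orientation of $y$). Let $\ddot\Lambda=\mathbb{Z}[t^{\pm1},s]/(s^2-(1-t)s)$. A $(t,s)$-rack is a $\ddot\Lambda$-module $X$ regarded as a rack with $x\triangleright y=tx+sy$ and $x\triangleright^{-1}y=t^{-1}(x-sy)$; it is an Alexander quandle if $sx=(1-t)x$ for all $x\in X$, so that $x\triangleright y=tx+(1-t)y$. For a subset $S\subset X$, $AC(S)$ denotes the subgroup of the additive group of $X$ generated by $S$. For a finite Alexander quandle $X$ and a knot $K$, the additive $(t,s)$-rack enhanced polynomial is \[\Phi^{ts,+}_X(K)=\sum_{f\in\mathrm{Hom}(Q(K),X)}u^{|AC(\mathrm{Im}(f))|}\in\mathbb{Z}[u],\]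 where $\mathrm{Hom}(Q(K),X)$ is the set of quandle homomorphisms. (In general the polynomial is a sum over framings modulo the rack rank of $X$; for a quandle the rack rank is $1$ and this is the resulting formula.) The partial order $\succ$ on $\mathbb{Z}[u]$ is defined by $\sum_{k=0}^n\alpha_ku^k\succ\sum_{k=0}^n\beta_ku^k$ if and only if $\alpha_k\ge\beta_k$ for all $k=0,\dots,n$. *)

theory Defs
  imports
    "HOL-Analysis.Analysis"
    "HOL-Algebra.QuotRing"
    "HOL-Algebra.Module"
    "HOL-Algebra.Generated_Groups"
    "HOL-Library.Poly_Mapping"
    "HOL-Computational_Algebra.Polynomial"
begin

section \<open>Racks and quandles\<close>

text \<open>The operation \<open>\<triangleleft>\<close> is the inverse operation, written \<open>\<triangleright>\<close> with exponent
  \<open>-1\<close> in the literature.\<close>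

record 'a rack = "'a partial_object" +
  rack_op :: "'a \<Rightarrow> 'a \<Rightarrow> 'a" (infixl "\<triangleright>\<index>" 70)
  rack_inv :: "'a \<Rightarrow> 'a \<Rightarrow> 'a" (infixl "\<triangleleft>\<index>" 70)

locale rack =
  fixes Q (structure)
  assumes op_closed: "x \<in> carrier Q \<Longrightarrow> y \<in> carrier Q \<Longrightarrow> x \<triangleright> y \<in> carrier Q"
    and inv_closed: "x \<in> carrier Q \<Longrightarrow> y \<in> carrier Q \<Longrightarrow> x \<triangleleft> y \<in> carrier Q"
    and op_inv: "x \<in> carrier Q \<Longrightarrow> y \<in> carrier Q \<Longrightarrow> (x \<triangleright> y) \<triangleleft> y = x"
    and inv_op: "x \<in> carrier Q \<Longrightarrow> y \<in> carrier Q \<Longrightarrow> (x \<triangleleft> y) \<triangleright> y = x"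
    and self_distrib: "x \<in> carrier Q \<Longrightarrow> y \<in> carrier Q \<Longrightarrow> z \<in> carrier Q \<Longrightarrow>
      (x \<triangleright> y) \<triangleright> z = (x \<triangleright> z) \<triangleright> (y \<triangleright> z)"

locale quandle = rack +
  assumes idem: "x \<in> carrier Q \<Longrightarrow> x \<triangleright> x = x"

text \<open>Homomorphisms are taken to be extensional on the carrier, so that each of them is
  represented by exactly one HOL function.\<close>

definition rack_hom :: "('a, 'm) rack_scheme \<Rightarrow> ('b, 'n) rack_scheme \<Rightarrow> ('a \<Rightarrow> 'b) set" where
  "rack_hom Q R = {f \<in> carrier Q \<rightarrow>\<^sub>E carrier R.
     \<forall>x \<in> carrier Q. \<forall>y \<in> carrier Q.
       f (x \<triangleright>\<^bsub>Q\<^esub> y) = f x \<triangleright>\<^bsub>R\<^esub> f y \<and> f (x \<triangleleft>\<^bsub>Q\<^esub> y) = f x \<triangleleft>\<^bsub>R\<^esub> f y}"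


section \<open>Quandles presented by generators and relations\<close>

datatype 'g quandle_term =
    Gen 'g
  | Op "'g quandle_term" "'g quandle_term"
  | OpInv "'g quandle_term" "'g quandle_term"

definition quandle_terms :: "'g set \<Rightarrow> 'g quandle_term set" where
  "quandle_terms G = {a. set_quandle_term a \<subseteq> G}"

inductive_set quandle_congruence ::
  "'g set \<Rightarrow> ('g quandle_term \<times> 'g quandle_term) set \<Rightarrow> ('g quandle_term \<times> 'g quandle_term) set"
  for G :: "'g set" and R :: "('g quandle_term \<times> 'g quandle_term) set" where
  relation: "(a, b) \<in> R \<Longrightarrow> a \<in> quandle_terms G \<Longrightarrow> b \<in> quandle_terms G \<Longrightarrow>
    (a, b) \<in> quandle_congruence G R"
| refl: "a \<in> quandle_terms G \<Longrightarrow> (a, a) \<in> quandle_congruence G R"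
| sym: "(a, b) \<in> quandle_congruence G R \<Longrightarrow> (b, a) \<in> quandle_congruence G R"
| trans: "(a, b) \<in> quandle_congruence G R \<Longrightarrow> (b, c) \<in> quandle_congruence G R \<Longrightarrow>
    (a, c) \<in> quandle_congruence G R"
| Op: "(a, a') \<in> quandle_congruence G R \<Longrightarrow> (b, b') \<in> quandle_congruence G R \<Longrightarrow>
    (Op a b, Op a' b') \<in> quandle_congruence G R"
| OpInv: "(a, a') \<in> quandle_congruence G R \<Longrightarrow> (b, b') \<in> quandle_congruence G R \<Longrightarrow>
    (OpInv a b, OpInv a' b') \<in> quandle_congruence G R"
| op_inv: "a \<in> quandle_terms G \<Longrightarrow> b \<in> quandle_terms G \<Longrightarrow>
    (OpInv (Op a b) b, a) \<in> quandle_congruence G R"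
| inv_op: "a \<in> quandle_terms G \<Longrightarrow> b \<in> quandle_terms G \<Longrightarrow>
    (Op (OpInv a b) b, a) \<in> quandle_congruence G R"
| self_distrib: "a \<in> quandle_terms G \<Longrightarrow> b \<in> quandle_terms G \<Longrightarrow> c \<in> quandle_terms G \<Longrightarrow>
    (Op (Op a b) c, Op (Op a c) (Op b c)) \<in> quandle_congruence G R"
| idem: "a \<in> quandle_terms G \<Longrightarrow> (Op a a, a) \<in> quandle_congruence G R"

definition presented_quandle ::
  "'g set \<Rightarrow> ('g quandle_term \<times> 'g quandle_term) set \<Rightarrow> 'g quandle_term set rack" where
  "presented_quandle G R =
     \<lparr>carrier = quandle_terms G // quandle_congruence G R,
      rack_op = (\<lambda>A B. \<Union>a\<in>A. \<Union>b\<in>B. quandle_congruence G R `` {Op a b}),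
      rack_inv = (\<lambda>A B. \<Union>a\<in>A. \<Union>b\<in>B. quandle_congruence G R `` {OpInv a b})\<rparr>"

lemma quandle_terms_simps [simp]:
  "Gen g \<in> quandle_terms G \<longleftrightarrow> g \<in> G"
  "Op a b \<in> quandle_terms G \<longleftrightarrow> a \<in> quandle_terms G \<and> b \<in> quandle_terms G"
  "OpInv a b \<in> quandle_terms G \<longleftrightarrow> a \<in> quandle_terms G \<and> b \<in> quandle_terms G"
  by (auto simp: quandle_terms_def)

lemma quandle_congruence_terms:
  "(a, b) \<in> quandle_congruence G R \<Longrightarrow> a \<in> quandle_terms G \<and> b \<in> quandle_terms G"
  by (induction rule: quandle_congruence.induct) auto

lemma equiv_quandle_congruence: "equiv (quandle_terms G) (quandle_congruence G R)"
  by (rule equivI)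
    (auto simp: refl_on_def sym_def trans_def dest: quandle_congruence_terms
      intro: quandle_congruence.refl quandle_congruence.sym quandle_congruence.trans)

lemma presented_quandle_ops:
  assumes "a \<in> quandle_terms G" and "b \<in> quandle_terms G"
  shows "quandle_congruence G R `` {a} \<triangleright>\<^bsub>presented_quandle G R\<^esub> quandle_congruence G R `` {b}
      = quandle_congruence G R `` {Op a b}"
    and "quandle_congruence G R `` {a} \<triangleleft>\<^bsub>presented_quandle G R\<^esub> quandle_congruence G R `` {b}
      = quandle_congruence G R `` {OpInv a b}"
proof -
  have "(\<lambda>a b. quandle_congruence G R `` {Op a b}) respects2 quandle_congruence G R"
    "(\<lambda>a b. quandle_congruence G R `` {OpInv a b}) respects2 quandle_congruence G R"
    by (auto simp: congruent2_def intro!: equiv_class_eq[OF equiv_quandle_congruence]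
        intro: quandle_congruence.Op quandle_congruence.OpInv)
  from this[THEN UN_equiv_class2[OF equiv_quandle_congruence equiv_quandle_congruence]] assms
  show "quandle_congruence G R `` {a} \<triangleright>\<^bsub>presented_quandle G R\<^esub> quandle_congruence G R `` {b}
      = quandle_congruence G R `` {Op a b}"
    and "quandle_congruence G R `` {a} \<triangleleft>\<^bsub>presented_quandle G R\<^esub> quandle_congruence G R `` {b}
      = quandle_congruence G R `` {OpInv a b}"
    by (simp_all add: presented_quandle_def)
qed

lemma quandle_presented_quandle: "quandle (presented_quandle G R)"
proof -
  let ?E = "quandle_congruence G R" and ?Q = "presented_quandle G R"
  have rep: "\<exists>a \<in> quandle_terms G. A = ?E `` {a}" if "A \<in> carrier ?Q" for A
    using that by (auto simp: presented_quandle_def quotient_def)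
  have cl: "?E `` {a} \<in> carrier ?Q" if "a \<in> quandle_terms G" for a
    using that by (auto simp: presented_quandle_def quotient_def)
  note eq = equiv_class_eq[OF equiv_quandle_congruence]
  note [simp] = presented_quandle_ops cl
  show ?thesis
  proof
    fix A B C assume "A \<in> carrier ?Q" "B \<in> carrier ?Q" "C \<in> carrier ?Q"
    then obtain a b c where "A = ?E `` {a}" "B = ?E `` {b}" "C = ?E `` {c}"
      and "a \<in> quandle_terms G" "b \<in> quandle_terms G" "c \<in> quandle_terms G"
      using rep by meson
    then show "(A \<triangleright>\<^bsub>?Q\<^esub> B) \<triangleright>\<^bsub>?Q\<^esub> C = (A \<triangleright>\<^bsub>?Q\<^esub> C) \<triangleright>\<^bsub>?Q\<^esub> (B \<triangleright>\<^bsub>?Q\<^esub> C)"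
      using eq[OF quandle_congruence.self_distrib[of a G b c]] by simp
  next
    fix A B assume "A \<in> carrier ?Q" "B \<in> carrier ?Q"
    then obtain a b where "A = ?E `` {a}" "B = ?E `` {b}"
      and "a \<in> quandle_terms G" "b \<in> quandle_terms G"
      using rep by meson
    then show "A \<triangleright>\<^bsub>?Q\<^esub> B \<in> carrier ?Q" "A \<triangleleft>\<^bsub>?Q\<^esub> B \<in> carrier ?Q"
      "(A \<triangleright>\<^bsub>?Q\<^esub> B) \<triangleleft>\<^bsub>?Q\<^esub> B = A" "(A \<triangleleft>\<^bsub>?Q\<^esub> B) \<triangleright>\<^bsub>?Q\<^esub> B = A"
      by (simp_all add: eq[OF quandle_congruence.op_inv] eq[OF quandle_congruence.inv_op])
  next
    fix A assume "A \<in> carrier ?Q"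
    then obtain a where "A = ?E `` {a}" "a \<in> quandle_terms G"
      using rep by meson
    then show "A \<triangleright>\<^bsub>?Q\<^esub> A = A"
      by (simp add: eq[OF quandle_congruence.idem])
  qed
qed


section \<open>Oriented knots and their diagrams\<close>

text \<open>The 3-sphere is the unit sphere of \<open>\<real>\<^sup>3 \<times> \<real>\<close>, with the orientation for which inverse
  stereographic projection from \<open>\<real>\<^sup>3\<close> preserves orientation.\<close>

abbreviation S3 :: "((real^3) \<times> real) set" where
  "S3 \<equiv> sphere 0 1"

definition stereographic_inv :: "real^3 \<Rightarrow> (real^3) \<times> real" where
  "stereographic_inv v =
     ((2 / ((norm v)\<^sup>2 + 1)) *\<^sub>R v, ((norm v)\<^sup>2 - 1) / ((norm v)\<^sup>2 + 1))"

definition oriented_knot :: "(real \<Rightarrow> (real^3) \<times> real) \<Rightarrow> bool" where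
  "oriented_knot K \<longleftrightarrow> simple_path K \<and> pathfinish K = pathstart K \<and> path_image K \<subseteq> S3"

definition ambient_isotopic :: "(real \<Rightarrow> (real^3) \<times> real) \<Rightarrow> (real \<Rightarrow> (real^3) \<times> real) \<Rightarrow> bool" where
  "ambient_isotopic K L \<longleftrightarrow>
     (\<exists>h. homotopic_with_canon (\<lambda>g. \<exists>g'. homeomorphism S3 S3 g g') S3 S3 id h \<and>
          (\<forall>t\<in>{0..1}. h (K t) = L t))"

text \<open>A closed polygon in \<open>\<real>\<^sup>3\<close> is given by the cyclic list of its vertices and is oriented by
  the order of the list.\<close>

definition vertex :: "(real^3) list \<Rightarrow> nat \<Rightarrow> real^3" where
  "vertex P i = P ! (i mod length P)"

definition polygon_loop :: "(real^3) list \<Rightarrow> real \<Rightarrow> real^3" where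
  "polygon_loop P t =
     (let x = real (length P) * t; i = nat \<lfloor>x\<rfloor>
      in linepath (vertex P i) (vertex P (Suc i)) (frac x))"

text \<open>A diagram is a closed simple polygon in regular position with respect to the vertical
  projection; the third coordinate of a point decides which strand passes over. If only finitely
  many points of the plane have several preimages, all of them double and none of them the image
  of a vertex, then these points are transversal crossings of two edges.\<close>

definition proj :: "real^3 \<Rightarrow> real \<times> real" where
  "proj v = (v $ 1, v $ 2)"

definition multiple_points :: "(real^3) list \<Rightarrow> (real \<times> real) set" where
  "multiple_points P =
     {x. \<exists>p \<in> path_image (polygon_loop P). \<exists>q \<in> path_image (polygon_loop P).
           p \<noteq> q \<and> proj p = x \<and> proj q = x}"

definition oriented_diagram :: "(real^3) list \<Rightarrow> bool" where
  "oriented_diagram P \<longleftrightarrow>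
     simple_path (polygon_loop P) \<and>
     finite (multiple_points P) \<and>
     (\<forall>x \<in> multiple_points P. card {p \<in> path_image (polygon_loop P). proj p = x} = 2) \<and>
     (\<forall>v \<in> set P. proj v \<notin> multiple_points P)"

text \<open>Orientation preserving reparametrisations of a tame knot are ambient isotopic to it, so
  comparing the given parametrisations is no restriction. A knot that has a diagram in this
  sense is tame.\<close>

definition diagram_of :: "(real^3) list \<Rightarrow> (real \<Rightarrow> (real^3) \<times> real) \<Rightarrow> bool" where
  "diagram_of P K \<longleftrightarrow>
     oriented_diagram P \<and> ambient_isotopic K (stereographic_inv \<circ> polygon_loop P)"

definition crosses_over :: "(real^3) list \<Rightarrow> real^3 \<Rightarrow> real^3 \<Rightarrow> bool" where
  "crosses_over P p q \<longleftrightarrow>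
     p \<in> path_image (polygon_loop P) \<and> q \<in> path_image (polygon_loop P) \<and>
     proj p = proj q \<and> q $ 3 < p $ 3"

text \<open>The arcs are the pieces into which the undercrossing points cut the polygon.\<close>

definition arcs :: "(real^3) list \<Rightarrow> (real^3) set set" where
  "arcs P = components (path_image (polygon_loop P) - {q. \<exists>p. crosses_over P p q})"

text \<open>The vector \<open>d\<close> is the direction of the overcrossing edge at \<open>p\<close>. The positive determinant
  says that \<open>w\<close> points from the right of that edge to its left; since \<open>q + e *\<^sub>R w\<close> and
  \<open>q - e *\<^sub>R w\<close> lie on the diagram for small \<open>e\<close>, \<open>w\<close> is tangent to the lower strand (in either
  direction). Hence \<open>x\<close> is the under-arc on the right of \<open>y\<close> and \<open>z\<close> the one on the left.\<close>

definition crossing_arcs ::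
  "(real^3) list \<Rightarrow> (real^3) set \<Rightarrow> (real^3) set \<Rightarrow> (real^3) set \<Rightarrow> bool" where
  "crossing_arcs P x y z \<longleftrightarrow>
     x \<in> arcs P \<and> y \<in> arcs P \<and> z \<in> arcs P \<and>
     (\<exists>p q i d w.
        crosses_over P p q \<and> p \<in> y \<and>
        p \<in> open_segment (vertex P i) (vertex P (Suc i)) \<and>
        d = vertex P (Suc i) - vertex P i \<and>
        d $ 1 * w $ 2 - d $ 2 * w $ 1 > 0 \<and>
        (\<forall>\<^sub>F e in at_right 0. q - e *\<^sub>R w \<in> x \<and> q + e *\<^sub>R w \<in> z))"

definition knot_quandle :: "(real^3) list \<Rightarrow> (real^3) set quandle_term set rack" where
  "knot_quandle P =
     presented_quandle (arcs P)
       {(Gen z, Op (Gen x) (Gen y)) | x y z. crossing_arcs P x y z}"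


section \<open>\<open>(t,s)\<close>-racks and Alexander quandles\<close>

text \<open>Laurent polynomials in \<open>t\<close> over the integers are the type \<open>int \<Rightarrow>\<^sub>0 int\<close> (exponents to
  coefficients, with the convolution product); polynomials in \<open>s\<close> over them are the type
  \<open>(int \<Rightarrow>\<^sub>0 int) poly\<close>.\<close>

type_synonym ts_poly = "(int \<Rightarrow>\<^sub>0 int) poly"

definition ts_poly_ring :: "ts_poly ring" where
  "ts_poly_ring = \<lparr>carrier = UNIV, mult = (*), one = 1, zero = 0, add = (+)\<rparr>"

definition t_poly :: ts_poly where
  "t_poly = [:Poly_Mapping.single 1 1:]"

definition t_inv_poly :: ts_poly where
  "t_inv_poly = [:Poly_Mapping.single (-1) 1:]"

definition s_poly :: ts_poly where
  "s_poly = [:0, 1:]"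

definition ts_ideal :: "ts_poly set" where
  "ts_ideal = PIdl\<^bsub>ts_poly_ring\<^esub> (s_poly\<^sup>2 - (1 - t_poly) * s_poly)"

definition ts_ring :: "ts_poly set ring" where
  "ts_ring = ts_poly_ring Quot ts_ideal"

definition t_elem :: "ts_poly set" where
  "t_elem = ts_ideal +>\<^bsub>ts_poly_ring\<^esub> t_poly"

definition t_inv_elem :: "ts_poly set" where
  "t_inv_elem = ts_ideal +>\<^bsub>ts_poly_ring\<^esub> t_inv_poly"

definition s_elem :: "ts_poly set" where
  "s_elem = ts_ideal +>\<^bsub>ts_poly_ring\<^esub> s_poly"

definition ts_rack :: "(ts_poly set, 'a) module \<Rightarrow> 'a rack" where
  "ts_rack X =
     \<lparr>carrier = carrier X,
      rack_op = (\<lambda>x y. (t_elem \<odot>\<^bsub>X\<^esub> x) \<oplus>\<^bsub>X\<^esub> (s_elem \<odot>\<^bsub>X\<^esub> y)),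
      rack_inv = (\<lambda>x y. t_inv_elem \<odot>\<^bsub>X\<^esub> (x \<ominus>\<^bsub>X\<^esub> (s_elem \<odot>\<^bsub>X\<^esub> y)))\<rparr>"

definition alexander_quandle :: "(ts_poly set, 'a) module \<Rightarrow> bool" where
  "alexander_quandle X \<longleftrightarrow>
     Module.module ts_ring X \<and>
     (\<forall>x \<in> carrier X. s_elem \<odot>\<^bsub>X\<^esub> x = (\<one>\<^bsub>ts_ring\<^esub> \<ominus>\<^bsub>ts_ring\<^esub> t_elem) \<odot>\<^bsub>X\<^esub> x)"

lemma cring_ts_poly_ring: "cring ts_poly_ring"
proof (intro cringI abelian_groupI comm_monoidI)
  fix x assume "x \<in> carrier ts_poly_ring"
  show "\<exists>y \<in> carrier ts_poly_ring. y \<oplus>\<^bsub>ts_poly_ring\<^esub> x = \<zero>\<^bsub>ts_poly_ring\<^esub>"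
    by (intro bexI[of _ "- x"]) (auto simp: ts_poly_ring_def)
qed (auto simp: ts_poly_ring_def algebra_simps)

lemma ideal_ts_ideal: "ideal ts_ideal ts_poly_ring"
  unfolding ts_ideal_def
  by (rule cring.cgenideal_ideal[OF cring_ts_poly_ring]) (simp add: ts_poly_ring_def)

lemma cring_ts_ring: "cring ts_ring"
  unfolding ts_ring_def by (rule ideal.quotient_is_cring[OF ideal_ts_ideal cring_ts_poly_ring])

lemma ts_elem_closed:
  "t_elem \<in> carrier ts_ring" "t_inv_elem \<in> carrier ts_ring" "s_elem \<in> carrier ts_ring"
  by (auto simp: t_elem_def t_inv_elem_def s_elem_def ts_ring_def FactRing_def A_RCOSETS_def'
      ts_poly_ring_def)

lemma ts_ring_relations:
  "t_elem \<otimes>\<^bsub>ts_ring\<^esub> t_inv_elem = \<one>\<^bsub>ts_ring\<^esub>"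
  "s_elem \<otimes>\<^bsub>ts_ring\<^esub> s_elem = (\<one>\<^bsub>ts_ring\<^esub> \<ominus>\<^bsub>ts_ring\<^esub> t_elem) \<otimes>\<^bsub>ts_ring\<^esub> s_elem"
proof -
  interpret R: cring ts_poly_ring
    by (rule cring_ts_poly_ring)
  interpret h: ring_hom_ring ts_poly_ring ts_ring "(+>\<^bsub>ts_poly_ring\<^esub>) ts_ideal"
    unfolding ts_ring_def by (rule ideal.rcos_ring_hom_ring[OF ideal_ts_ideal])
  have car: "a \<in> carrier ts_poly_ring" for a
    by (simp add: ts_poly_ring_def)
  have uminus: "\<ominus>\<^bsub>ts_poly_ring\<^esub> a = - a" for a
    by (rule R.minus_equality) (auto simp: ts_poly_ring_def)
  have minus: "a \<ominus>\<^bsub>ts_poly_ring\<^esub> b = a - b" for a b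
    by (simp add: R.minus_eq uminus) (simp add: ts_poly_ring_def)
  have h: "(ts_ideal +>\<^bsub>ts_poly_ring\<^esub> a) \<otimes>\<^bsub>ts_ring\<^esub> (ts_ideal +>\<^bsub>ts_poly_ring\<^esub> b)
        = ts_ideal +>\<^bsub>ts_poly_ring\<^esub> (a * b)"
    "(ts_ideal +>\<^bsub>ts_poly_ring\<^esub> a) \<ominus>\<^bsub>ts_ring\<^esub> (ts_ideal +>\<^bsub>ts_poly_ring\<^esub> b)
        = ts_ideal +>\<^bsub>ts_poly_ring\<^esub> (a - b)"
    "\<one>\<^bsub>ts_ring\<^esub> = ts_ideal +>\<^bsub>ts_poly_ring\<^esub> 1" for a b
  proof -
    show "(ts_ideal +>\<^bsub>ts_poly_ring\<^esub> a) \<otimes>\<^bsub>ts_ring\<^esub> (ts_ideal +>\<^bsub>ts_poly_ring\<^esub> b)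
        = ts_ideal +>\<^bsub>ts_poly_ring\<^esub> (a * b)"
      using h.hom_mult[OF car car, of a b] by (simp add: ts_poly_ring_def)
    have "(ts_ideal +>\<^bsub>ts_poly_ring\<^esub> a) \<ominus>\<^bsub>ts_ring\<^esub> (ts_ideal +>\<^bsub>ts_poly_ring\<^esub> b)
        = ts_ideal +>\<^bsub>ts_poly_ring\<^esub> (a \<ominus>\<^bsub>ts_poly_ring\<^esub> b)"
      unfolding R.minus_eq h.S.minus_eq
      by (simp only: h.hom_add h.hom_a_inv car)
    then show "(ts_ideal +>\<^bsub>ts_poly_ring\<^esub> a) \<ominus>\<^bsub>ts_ring\<^esub> (ts_ideal +>\<^bsub>ts_poly_ring\<^esub> b)
        = ts_ideal +>\<^bsub>ts_poly_ring\<^esub> (a - b)"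
      by (simp add: minus)
    show "\<one>\<^bsub>ts_ring\<^esub> = ts_ideal +>\<^bsub>ts_poly_ring\<^esub> 1"
      using h.hom_one by (simp add: ts_poly_ring_def)
  qed
  have "t_poly * t_inv_poly = 1"
    by (simp add: t_poly_def t_inv_poly_def mult_single)
  then show "t_elem \<otimes>\<^bsub>ts_ring\<^esub> t_inv_elem = \<one>\<^bsub>ts_ring\<^esub>"
    by (simp add: t_elem_def t_inv_elem_def h)
  have "s_poly * s_poly \<ominus>\<^bsub>ts_poly_ring\<^esub> (1 - t_poly) * s_poly \<in> ts_ideal"
    using R.cgenideal_self[OF car] unfolding ts_ideal_def minus by (simp add: power2_eq_square)
  then show "s_elem \<otimes>\<^bsub>ts_ring\<^esub> s_elem
      = (\<one>\<^bsub>ts_ring\<^esub> \<ominus>\<^bsub>ts_ring\<^esub> t_elem) \<otimes>\<^bsub>ts_ring\<^esub> s_elem"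
    unfolding R.quotient_eq_iff_same_a_r_cos[OF ideal_ts_ideal car car]
    by (simp add: t_elem_def s_elem_def h)
qed

lemma t_plus_one_minus_t:
  "t_elem \<oplus>\<^bsub>ts_ring\<^esub> (\<one>\<^bsub>ts_ring\<^esub> \<ominus>\<^bsub>ts_ring\<^esub> t_elem) = \<one>\<^bsub>ts_ring\<^esub>"
proof -
  interpret cring ts_ring by (rule cring_ts_ring)
  have "(\<one>\<^bsub>ts_ring\<^esub> \<ominus>\<^bsub>ts_ring\<^esub> t_elem) \<oplus>\<^bsub>ts_ring\<^esub> t_elem = \<one>\<^bsub>ts_ring\<^esub>"
    by (simp add: minus_eq a_assoc l_neg ts_elem_closed)
  then show ?thesis
    using a_comm[of t_elem] by (simp add: ts_elem_closed)
qed

lemma rack_ts_rack: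
  assumes "Module.module ts_ring X"
  shows "rack (ts_rack X)"
proof -
  interpret Module.module ts_ring X by fact
  note [simp] = ts_elem_closed
  have tt: "t_elem \<odot>\<^bsub>X\<^esub> (t_inv_elem \<odot>\<^bsub>X\<^esub> x) = x" "t_inv_elem \<odot>\<^bsub>X\<^esub> (t_elem \<odot>\<^bsub>X\<^esub> x) = x"
    if "x \<in> carrier X" for x
    using that ts_ring_relations(1) R.m_comm[of t_elem t_inv_elem]
    by (simp_all flip: smult_assoc1)
  have ts: "s_elem \<odot>\<^bsub>X\<^esub> (t_elem \<odot>\<^bsub>X\<^esub> x) = t_elem \<odot>\<^bsub>X\<^esub> (s_elem \<odot>\<^bsub>X\<^esub> x)"
    if "x \<in> carrier X" for x
    using that R.m_comm[of t_elem s_elem] by (simp flip: smult_assoc1)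
  have ss: "t_elem \<odot>\<^bsub>X\<^esub> (s_elem \<odot>\<^bsub>X\<^esub> x) \<oplus>\<^bsub>X\<^esub> s_elem \<odot>\<^bsub>X\<^esub> (s_elem \<odot>\<^bsub>X\<^esub> x) = s_elem \<odot>\<^bsub>X\<^esub> x"
    if x: "x \<in> carrier X" for x
  proof -
    have "s_elem \<odot>\<^bsub>X\<^esub> (s_elem \<odot>\<^bsub>X\<^esub> x)
        = (\<one>\<^bsub>ts_ring\<^esub> \<ominus>\<^bsub>ts_ring\<^esub> t_elem) \<odot>\<^bsub>X\<^esub> (s_elem \<odot>\<^bsub>X\<^esub> x)"
      using x smult_assoc1[of s_elem s_elem x]
        smult_assoc1[of "\<one>\<^bsub>ts_ring\<^esub> \<ominus>\<^bsub>ts_ring\<^esub> t_elem" s_elem x]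
      by (simp add: ts_ring_relations(2))
    then have "t_elem \<odot>\<^bsub>X\<^esub> (s_elem \<odot>\<^bsub>X\<^esub> x) \<oplus>\<^bsub>X\<^esub> s_elem \<odot>\<^bsub>X\<^esub> (s_elem \<odot>\<^bsub>X\<^esub> x)
        = (t_elem \<oplus>\<^bsub>ts_ring\<^esub> (\<one>\<^bsub>ts_ring\<^esub> \<ominus>\<^bsub>ts_ring\<^esub> t_elem)) \<odot>\<^bsub>X\<^esub> (s_elem \<odot>\<^bsub>X\<^esub> x)"
      using x by (simp add: smult_l_distr)
    also have "t_elem \<oplus>\<^bsub>ts_ring\<^esub> (\<one>\<^bsub>ts_ring\<^esub> \<ominus>\<^bsub>ts_ring\<^esub> t_elem) = \<one>\<^bsub>ts_ring\<^esub>"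
      by (rule t_plus_one_minus_t)
    finally show ?thesis using x by simp
  qed
  have dist: "t_elem \<odot>\<^bsub>X\<^esub> (t_elem \<odot>\<^bsub>X\<^esub> x \<oplus>\<^bsub>X\<^esub> s_elem \<odot>\<^bsub>X\<^esub> y) \<oplus>\<^bsub>X\<^esub> s_elem \<odot>\<^bsub>X\<^esub> z =
      t_elem \<odot>\<^bsub>X\<^esub> (t_elem \<odot>\<^bsub>X\<^esub> x \<oplus>\<^bsub>X\<^esub> s_elem \<odot>\<^bsub>X\<^esub> z) \<oplus>\<^bsub>X\<^esub>
        s_elem \<odot>\<^bsub>X\<^esub> (t_elem \<odot>\<^bsub>X\<^esub> y \<oplus>\<^bsub>X\<^esub> s_elem \<odot>\<^bsub>X\<^esub> z)"
    if "x \<in> carrier X" "y \<in> carrier X" "z \<in> carrier X" for x y z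
    using that ss[of z]
    by (simp add: smult_r_distr ts M.a_assoc M.a_lcomm[of "t_elem \<odot>\<^bsub>X\<^esub> (s_elem \<odot>\<^bsub>X\<^esub> z)"])
  show ?thesis
  proof
    fix x y z
    assume "x \<in> carrier (ts_rack X)" "y \<in> carrier (ts_rack X)" "z \<in> carrier (ts_rack X)"
    then show "(x \<triangleright>\<^bsub>ts_rack X\<^esub> y) \<triangleright>\<^bsub>ts_rack X\<^esub> z
        = (x \<triangleright>\<^bsub>ts_rack X\<^esub> z) \<triangleright>\<^bsub>ts_rack X\<^esub> (y \<triangleright>\<^bsub>ts_rack X\<^esub> z)"
      using dist[of x y z] by (simp add: ts_rack_def)
  qed (auto simp: ts_rack_def tt M.minus_eq M.a_assoc M.l_neg M.r_neg)
qed

lemma quandle_ts_rack: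
  assumes "alexander_quandle X"
  shows "quandle (ts_rack X)"
proof -
  interpret Module.module ts_ring X
    using assms by (simp add: alexander_quandle_def)
  interpret T: rack "ts_rack X"
    by (rule rack_ts_rack) unfold_locales
  note [simp] = ts_elem_closed
  show ?thesis
  proof
    fix x assume "x \<in> carrier (ts_rack X)"
    then have x: "x \<in> carrier X" by (simp add: ts_rack_def)
    have "x \<triangleright>\<^bsub>ts_rack X\<^esub> x
        = (t_elem \<oplus>\<^bsub>ts_ring\<^esub> (\<one>\<^bsub>ts_ring\<^esub> \<ominus>\<^bsub>ts_ring\<^esub> t_elem)) \<odot>\<^bsub>X\<^esub> x"
      using x assms by (simp add: alexander_quandle_def ts_rack_def smult_l_distr)
    also have "t_elem \<oplus>\<^bsub>ts_ring\<^esub> (\<one>\<^bsub>ts_ring\<^esub> \<ominus>\<^bsub>ts_ring\<^esub> t_elem) = \<one>\<^bsub>ts_ring\<^esub>"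
      by (rule t_plus_one_minus_t)
    finally show "x \<triangleright>\<^bsub>ts_rack X\<^esub> x = x" using x by simp
  qed
qed


section \<open>The enhanced polynomial\<close>

definition additive_closure :: "('r, 'a) module \<Rightarrow> 'a set \<Rightarrow> 'a set" where
  "additive_closure X S = generate (add_monoid X) S"

text \<open>For finite \<open>X\<close> the sum is finite, since \<open>knot_quandle P\<close> is generated by finitely many arcs.
  The formula is the one for Alexander quandles, where no summation over framings is needed.\<close>

definition enhanced_poly :: "(ts_poly set, 'a) module \<Rightarrow> (real^3) list \<Rightarrow> int poly" where
  "enhanced_poly X P =
     (\<Sum>f \<in> rack_hom (knot_quandle P) (ts_rack X).
        monom 1 (card (additive_closure X (f ` carrier (knot_quandle P)))))"

definition poly_succeeds :: "int poly \<Rightarrow> int poly \<Rightarrow> bool" (infix "\<succ>" 50) where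
  "p \<succ> q \<longleftrightarrow> (\<forall>k. coeff p k \<ge> coeff q k)"

end

theory Submission
  imports Defs
begin

text \<open>A surjective homomorphism \<open>g\<close> from \<open>Q(K)\<close> to \<open>Q(K')\<close> can be cancelled on the right, so
  precomposition with \<open>g\<close> embeds \<open>Hom(Q(K'), X)\<close> into \<open>Hom(Q(K), X)\<close>. It does not change the image
  of a homomorphism, again because \<open>g\<close> is onto, and the exponent of \<open>u\<close> depends on the image only.
  Hence the terms of the polynomial of \<open>K'\<close> occur among those of the polynomial of \<open>K\<close>, and the
  terms that are left over have nonnegative coefficients.

  The comparison of the two sums is meaningful only if \<open>Hom(Q(K), X)\<close> is finite; the sum over an
  infinite set would be \<open>0\<close> by convention. A homomorphism is determined by its values on the arcs of
  the diagram, so it remains to see that a diagram has finitely many arcs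
  (\<open>finite_arcs\<close>). The undercrossing points are finite in number and the loop is injective up to
  its endpoints, so they cut the parameter interval in finitely many places. The finitely many
  intervals between these places have connected images, and every arc contains one of the
  nonempty ones.\<close>


section \<open>A diagram has finitely many arcs\<close>

lemma finite_components_Union:
  assumes "finite F" and "\<And>A. A \<in> F \<Longrightarrow> connected A"
  shows "finite (components (\<Union>F))"
proof (rule finite_subset)
  show "components (\<Union>F) \<subseteq> (\<lambda>A. connected_component_set (\<Union>F) (SOME y. y \<in> A)) ` F"
  proof
    fix C assume "C \<in> components (\<Union>F)"
    then obtain x A where C: "C = connected_component_set (\<Union>F) x" and A: "x \<in> A" "A \<in> F"
      by (auto simp: components_def)
    have "(SOME y. y \<in> A) \<in> A"
      using A(1) by (rule someI)
    moreover have "A \<subseteq> C"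
      unfolding C using A assms(2) by (intro connected_component_maximal) auto
    ultimately have "(SOME y. y \<in> A) \<in> C" by blast
    then have "C = connected_component_set (\<Union>F) (SOME y. y \<in> A)"
      unfolding C by (metis connected_component_eq)
    then show "C \<in> (\<lambda>A. connected_component_set (\<Union>F) (SOME y. y \<in> A)) ` F"
      using A(2) by blast
  qed
qed (use assms(1) in simp)

text \<open>The pieces are indexed by the subsets of \<open>T\<close>: two points belong to the same piece if the same
  elements of \<open>T\<close> lie to their left. An element of \<open>T\<close> between two points of a piece would
  separate them.\<close>

lemma interval_minus_finite_pieces:
  fixes I T :: "real set"
  assumes "finite T" and "is_interval I"
  shows "\<exists>F. finite F \<and> (\<forall>A \<in> F. connected A) \<and> \<Union>F = I - T"
proof -
  define piece where "piece A = {x \<in> I - T. T \<inter> {..x} = A}" for A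
  have "is_interval (piece A)" for A
    unfolding is_interval_1
  proof (intro ballI allI impI)
    fix a b x assume ab: "a \<in> piece A" "b \<in> piece A" and x: "a \<le> x \<and> x \<le> b"
    have "T \<inter> {..a} \<subseteq> T \<inter> {..x}" "T \<inter> {..x} \<subseteq> T \<inter> {..b}"
      using x by auto
    then have left: "T \<inter> {..x} = A" "T \<inter> {..a} = A"
      using ab by (auto simp: piece_def)
    have "x \<notin> T"
    proof
      assume "x \<in> T"
      then have "x \<in> T \<inter> {..a}" using left by auto
      then have "x = a" using x by simp
      then show False using ab(1) \<open>x \<in> T\<close> by (simp add: piece_def)
    qed
    moreover have "x \<in> I"
      using assms(2) ab x unfolding is_interval_1 piece_def by blast
    ultimately show "x \<in> piece A"
      using left by (simp add: piece_def)
  qed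
  then have "\<forall>A \<in> piece ` Pow T. connected A"
    by (auto intro: is_interval_connected)
  moreover have "\<Union>(piece ` Pow T) = I - T"
  proof (intro subset_antisym subsetI)
    fix x assume "x \<in> I - T"
    then have "x \<in> piece (T \<inter> {..x})" by (simp add: piece_def)
    then show "x \<in> \<Union>(piece ` Pow T)" by blast
  next
    fix x assume "x \<in> \<Union>(piece ` Pow T)"
    then show "x \<in> I - T" unfolding piece_def by blast
  qed
  moreover have "finite (piece ` Pow T)"
    using assms(1) by simp
  ultimately show ?thesis by blast
qed

text \<open>Removing points from the curve is removing their preimages from the parameter interval, and
  these are finite in number because a simple path identifies at most its two endpoints.\<close>

lemma finite_components_simple_path_minus_finite:
  assumes c: "simple_path c" and U: "finite U"
  shows "finite (components (path_image c - U))"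
proof -
  have "inj_on c {0<..<1}"
  proof (rule inj_onI)
    fix x y :: real assume xy: "x \<in> {0<..<1}" "y \<in> {0<..<1}" "c x = c y"
    then have "x = y \<or> x = 0 \<and> y = 1 \<or> x = 1 \<and> y = 0"
      using c unfolding simple_path_def loop_free_def by (meson atLeastAtMost_iff greaterThanLessThan_iff less_imp_le)
    then show "x = y" using xy by simp
  qed
  then have "finite (c -` U \<inter> {0<..<1})"
    using U by (rule finite_vimage_IntI[rotated])
  then have "finite (insert 0 (insert 1 (c -` U \<inter> {0<..<1})))"
    by simp
  then have "finite ({0..1} \<inter> c -` U)"
    by (rule finite_subset[rotated]) auto
  then obtain F where F: "finite F" "\<And>A. A \<in> F \<Longrightarrow> connected A"
    "\<Union>F = {0..1} - ({0..1} \<inter> c -` U)"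
    using interval_minus_finite_pieces[of "{0..1} \<inter> c -` U" "{0..1}"] by (auto simp: is_interval_cc)
  have "continuous_on {0..1} c"
    using c by (simp add: simple_path_def path_def)
  then have "connected (c ` A)" if "A \<in> F" for A
    using F(2,3) that by (intro connected_continuous_image) (auto intro: continuous_on_subset)
  then have "finite (components (\<Union>((`) c ` F)))"
    using F(1) by (intro finite_components_Union) auto
  moreover have "\<Union>((`) c ` F) = c ` \<Union>F" by blast
  moreover have "c ` \<Union>F = path_image c - U"
    unfolding F(3) by (auto simp: path_image_def)
  ultimately show ?thesis by simp
qed

lemma finite_undercrossings:
  assumes "oriented_diagram P"
  shows "finite {q. \<exists>p. crosses_over P p q}"
proof (rule finite_subset)
  show "{q. \<exists>p. crosses_over P p q} \<subseteq>
      (\<Union>x \<in> multiple_points P. {p \<in> path_image (polygon_loop P). proj p = x})"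
  proof
    fix q assume "q \<in> {q. \<exists>p. crosses_over P p q}"
    then obtain p where q: "q \<in> path_image (polygon_loop P)"
      and p: "p \<in> path_image (polygon_loop P)" "proj p = proj q" "q $ 3 < p $ 3"
      by (auto simp: crosses_over_def)
    have "p \<noteq> q" using p(3) by blast
    then have "proj q \<in> multiple_points P"
      using p(1,2) q unfolding multiple_points_def by blast
    then show "q \<in> (\<Union>x \<in> multiple_points P. {p \<in> path_image (polygon_loop P). proj p = x})"
      using q by blast
  qed
  have "finite {p \<in> path_image (polygon_loop P). proj p = x}" if "x \<in> multiple_points P" for x
    using assms that by (intro card_ge_0_finite) (simp add: oriented_diagram_def)
  then show "finite (\<Union>x \<in> multiple_points P. {p \<in> path_image (polygon_loop P). proj p = x})"
    using assms by (auto simp: oriented_diagram_def)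
qed

lemma finite_arcs:
  assumes "oriented_diagram P"
  shows "finite (arcs P)"
  unfolding arcs_def using assms
  by (intro finite_components_simple_path_minus_finite finite_undercrossings)
    (simp add: oriented_diagram_def)


section \<open>Homomorphisms of racks\<close>

lemma rack_hom_presented_quandle_eqI:
  assumes f: "f \<in> rack_hom (presented_quandle G R) Y"
    and h: "h \<in> rack_hom (presented_quandle G R) Y"
    and gens: "\<And>g. g \<in> G \<Longrightarrow>
      f (quandle_congruence G R `` {Gen g}) = h (quandle_congruence G R `` {Gen g})"
  shows "f = h"
proof
  let ?Q = "presented_quandle G R" and ?E = "quandle_congruence G R"
  have cl: "?E `` {a} \<in> carrier ?Q" if "a \<in> quandle_terms G" for a
    using that by (auto simp: presented_quandle_def quotient_def)
  have hom: "k (?E `` {Op a b}) = k (?E `` {a}) \<triangleright>\<^bsub>Y\<^esub> k (?E `` {b})"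
    "k (?E `` {OpInv a b}) = k (?E `` {a}) \<triangleleft>\<^bsub>Y\<^esub> k (?E `` {b})"
    if "k \<in> rack_hom ?Q Y" "a \<in> quandle_terms G" "b \<in> quandle_terms G" for k a b
    using that cl by (auto simp: rack_hom_def simp flip: presented_quandle_ops)
  have terms: "f (?E `` {a}) = h (?E `` {a})" if "a \<in> quandle_terms G" for a
    using that by (induction a) (simp_all add: gens hom[OF f] hom[OF h])
  fix A
  show "f A = h A"
  proof (cases "A \<in> carrier ?Q")
    case True
    then obtain a where "a \<in> quandle_terms G" "A = ?E `` {a}"
      by (auto simp: presented_quandle_def quotient_def)
    then show ?thesis by (simp add: terms)
  next
    case False
    have "f \<in> carrier ?Q \<rightarrow>\<^sub>E carrier Y" "h \<in> carrier ?Q \<rightarrow>\<^sub>E carrier Y"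
      using f h unfolding rack_hom_def by blast+
    then show ?thesis using False by (metis PiE_arb)
  qed
qed

lemma finite_rack_hom_presented_quandle:
  assumes "finite G" and "finite (carrier Y)"
  shows "finite (rack_hom (presented_quandle G R) Y)"
proof (rule inj_on_finite)
  let ?vals = "\<lambda>f. \<lambda>g \<in> G. f (quandle_congruence G R `` {Gen g})"
  show "inj_on ?vals (rack_hom (presented_quandle G R) Y)"
  proof (rule inj_onI)
    fix f h
    assume f: "f \<in> rack_hom (presented_quandle G R) Y" and h: "h \<in> rack_hom (presented_quandle G R) Y"
      and eq: "?vals f = ?vals h"
    show "f = h"
    proof (rule rack_hom_presented_quandle_eqI[OF f h])
      fix g assume "g \<in> G"
      then show "f (quandle_congruence G R `` {Gen g}) = h (quandle_congruence G R `` {Gen g})"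
        using fun_cong[OF eq, of g] by simp
    qed
  qed
  have "quandle_congruence G R `` {Gen g} \<in> carrier (presented_quandle G R)" if "g \<in> G" for g
    using that by (auto simp: presented_quandle_def quotient_def)
  then show "?vals ` rack_hom (presented_quandle G R) Y \<subseteq> G \<rightarrow>\<^sub>E carrier Y"
    by (auto simp: rack_hom_def)
  show "finite (G \<rightarrow>\<^sub>E carrier Y)"
    using assms by (simp add: finite_PiE)
qed

lemma rack_hom_compose:
  assumes Q: "rack Q" and g: "g \<in> rack_hom Q R" and f: "f \<in> rack_hom R Y"
  shows "compose (carrier Q) f g \<in> rack_hom Q Y"
proof -
  have gx: "g x \<in> carrier R" if "x \<in> carrier Q" for x
    using g that by (auto simp: rack_hom_def)
  have "f y \<in> carrier Y" if "y \<in> carrier R" for y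
    using f that by (auto simp: rack_hom_def)
  moreover have "g (x \<triangleright>\<^bsub>Q\<^esub> y) = g x \<triangleright>\<^bsub>R\<^esub> g y \<and> g (x \<triangleleft>\<^bsub>Q\<^esub> y) = g x \<triangleleft>\<^bsub>R\<^esub> g y"
    if "x \<in> carrier Q" "y \<in> carrier Q" for x y
    using g that by (simp add: rack_hom_def)
  moreover have "f (x \<triangleright>\<^bsub>R\<^esub> y) = f x \<triangleright>\<^bsub>Y\<^esub> f y \<and> f (x \<triangleleft>\<^bsub>R\<^esub> y) = f x \<triangleleft>\<^bsub>Y\<^esub> f y"
    if "x \<in> carrier R" "y \<in> carrier R" for x y
    using f that by (simp add: rack_hom_def)
  ultimately show ?thesis
    by (simp add: rack_hom_def compose_def PiE_iff gx rack.op_closed[OF Q] rack.inv_closed[OF Q])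
qed

lemma inj_on_compose_surj:
  assumes "g ` A = B"
  shows "inj_on (\<lambda>f. compose A f g) (B \<rightarrow>\<^sub>E C)"
proof (rule inj_onI)
  fix f h assume fh: "f \<in> B \<rightarrow>\<^sub>E C" "h \<in> B \<rightarrow>\<^sub>E C" and eq: "compose A f g = compose A h g"
  show "f = h"
  proof (rule PiE_ext[OF fh])
    fix y assume "y \<in> B"
    then obtain x where "x \<in> A" "y = g x" using assms by blast
    then show "f y = h y" using fun_cong[OF eq, of x] by (simp add: compose_def)
  qed
qed


section \<open>Monotonicity of the enhanced polynomial\<close>

theorem proposition16:
  fixes K K' :: "real \<Rightarrow> (real^3) \<times> real"
    and P P' :: "(real^3) list"
    and X :: "(ts_poly set, 'a) module"
  assumes "oriented_knot K" and "oriented_knot K'"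
    and "diagram_of P K" and "diagram_of P' K'"
    and "\<exists>g \<in> rack_hom (knot_quandle P) (knot_quandle P').
           g ` carrier (knot_quandle P) = carrier (knot_quandle P')"
    and "alexander_quandle X" and "finite (carrier X)"
  shows "enhanced_poly X P \<succ> enhanced_poly X P'"
proof -
  let ?Q = "knot_quandle P" and ?Q' = "knot_quandle P'" and ?X = "ts_rack X"
  define wt :: "'a set \<Rightarrow> int poly" where "wt S = monom 1 (card (additive_closure X S))" for S
  obtain g where g: "g \<in> rack_hom ?Q ?Q'" and surj: "g ` carrier ?Q = carrier ?Q'"
    using assms(5) by blast
  define pull where "pull f = compose (carrier ?Q) f g" for f :: "(real^3) set quandle_term set \<Rightarrow> 'a"
  have "rack ?Q"
    unfolding knot_quandle_def by (rule quandle.axioms[OF quandle_presented_quandle])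
  then have pull_hom: "pull ` rack_hom ?Q' ?X \<subseteq> rack_hom ?Q ?X"
    unfolding pull_def using g by (auto intro: rack_hom_compose)
  have inj: "inj_on pull (rack_hom ?Q' ?X)"
    unfolding pull_def
    by (rule inj_on_subset[OF inj_on_compose_surj[OF surj]]) (auto simp: rack_hom_def)
  have image: "pull f ` carrier ?Q = f ` carrier ?Q'" for f
    unfolding pull_def surj[symmetric] by (auto simp: compose_def)
  have fin: "finite (rack_hom ?Q ?X)"
    unfolding knot_quandle_def using assms(3,7)
    by (intro finite_rack_hom_presented_quandle finite_arcs) (auto simp: diagram_of_def ts_rack_def)
  show ?thesis
    unfolding poly_succeeds_def
  proof
    fix k
    have "coeff (enhanced_poly X P') k = (\<Sum>f \<in> rack_hom ?Q' ?X. coeff (wt (f ` carrier ?Q')) k)"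
      by (simp add: enhanced_poly_def wt_def coeff_sum)
    also have "\<dots> = (\<Sum>f \<in> pull ` rack_hom ?Q' ?X. coeff (wt (f ` carrier ?Q)) k)"
      by (simp add: sum.reindex[OF inj] image)
    also have "\<dots> \<le> (\<Sum>f \<in> rack_hom ?Q ?X. coeff (wt (f ` carrier ?Q)) k)"
      using fin pull_hom by (rule sum_mono2) (simp add: wt_def)
    also have "\<dots> = coeff (enhanced_poly X P) k"
      by (simp add: enhanced_poly_def wt_def coeff_sum)
    finally show "coeff (enhanced_poly X P) k \<ge> coeff (enhanced_poly X P') k" .
  qed
qed

end
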